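(* Let $m\in\mathbb{N}$, let $f(z)=\sum_{n=0}^{\infty}a_nz^n\in\mathcal{B}$, $a:=|a_0|$, and let $\omega\in\mathcal{B}_m$. Then $$C_f(z):=B_0(f,r)+\frac{1+ar}{(1+a)(1-r)}\|f_0\|_r^2+|f(\omega(z))-a_0|\le 1$$ for all $z$ with $|z|=r\in[0,\zeta_m]$, where $\zeta_m$ is the unique root in $(0,1/3]$ of the equation $$r^m(3-5r)+3r-1=0,$$ or equivalently of $3r^m+2\sum_{k=1}^{m}r^k-1=0$. The upper bound $\zeta_m$ cannot be improved. Moreover, $$D_f(z):=|a_0|^2+B_1(f,r)+\frac{1+ar}{(1+a)(1-r)}\|f_0\|_r^2+|f(\omega(z))-a_0|\le 1$$ for all $z$ with $|z|=r\in[0,\eta_m]$, where $\eta_m$ is the unique root in $(0,1/2]$ of the equation $$r^m(2-3r)+2r-1=0,$$ or equivalently of $2r^m+\sum_{k=1}^{m}r^k-1=0$. The upper bound $\eta_m$ cannot be improved.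
   Context: $\mathbb{D}=\{z\in\mathbb{C}:|z|<1\}$ and $\mathbb{N}=\{1,2,\dots\}$. $\mathcal{B}$ is the class of analytic functions $f$ on $\mathbb{D}$ with $\sup_{z\in\mathbb{D}}|f(z)|\le 1$. For $m\in\mathbb{N}$, $\mathcal{B}_m$ is the set of $\omega\in\mathcal{B}$ with $\omega(0)=\omega'(0)=\cdots=\omega^{(m-1)}(0)=0$ and $\omega^{(m)}(0)\ne 0$. For $f(z)=\sum_{n\ge 0}a_nz^n\in\mathcal{B}$ put $f_0(z)=f(z)-f(0)$, $B_k(f,r)=\sum_{n=k}^{\infty}|a_n|r^n$ for $k\ge 0$, and $\|f_0\|_r^2=\sum_{n=1}^{\infty}|a_n|^2r^{2n}$. Throughout $r=|z|<1$. Saying that a constant $\rho$ (for given $m$) cannot be improved means that there is no $\rho'\in(\rho,1)$ such that the corresponding inequality holds for all $f\in\mathcal{B}$, all $\omega\in\mathcal{B}_m$ and all $z$ with $|z|\le\rho'$. *)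

theory Defs
  imports "HOL-Complex_Analysis.Complex_Analysis"
begin

abbreviation unit_disc :: "complex set" where
  "unit_disc \<equiv> ball 0 1"

text \<open>Functions are total, but every notion below depends only on values on the open unit disc.\<close>

definition bounded_class :: "(complex \<Rightarrow> complex) set" where
  "bounded_class = {f. f analytic_on unit_disc \<and> (\<forall>z\<in>unit_disc. cmod (f z) \<le> 1)}"

definition schwarz_class :: "nat \<Rightarrow> (complex \<Rightarrow> complex) set" where
  "schwarz_class m = {\<omega> \<in> bounded_class.
     (\<forall>k<m. (deriv ^^ k) \<omega> 0 = 0) \<and> (deriv ^^ m) \<omega> 0 \<noteq> 0}"

abbreviation taylor_coeff :: "(complex \<Rightarrow> complex) \<Rightarrow> nat \<Rightarrow> complex" where
  "taylor_coeff f n \<equiv> fps_nth (fps_expansion f 0) n"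

text \<open>For \<open>f\<close> analytic on the disc and \<open>0 \<le> r < 1\<close> both series below converge, since
  the Taylor series of \<open>f\<close> has radius of convergence at least 1.\<close>

definition majorant :: "nat \<Rightarrow> (complex \<Rightarrow> complex) \<Rightarrow> real \<Rightarrow> real" where
  "majorant k f r = (\<Sum>n. cmod (taylor_coeff f (n + k)) * r ^ (n + k))"

definition norm0_sq :: "(complex \<Rightarrow> complex) \<Rightarrow> real \<Rightarrow> real" where
  "norm0_sq f r = (\<Sum>n. (cmod (taylor_coeff f (n + 1)))\<^sup>2 * r ^ (2 * (n + 1)))"

definition C_fun :: "(complex \<Rightarrow> complex) \<Rightarrow> (complex \<Rightarrow> complex) \<Rightarrow> complex \<Rightarrow> real" where
  "C_fun f \<omega> z =
    (let r = cmod z; a = cmod (taylor_coeff f 0) in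
       majorant 0 f r
       + (1 + a * r) / ((1 + a) * (1 - r)) * norm0_sq f r
       + cmod (f (\<omega> z) - taylor_coeff f 0))"

definition D_fun :: "(complex \<Rightarrow> complex) \<Rightarrow> (complex \<Rightarrow> complex) \<Rightarrow> complex \<Rightarrow> real" where
  "D_fun f \<omega> z =
    (let r = cmod z; a = cmod (taylor_coeff f 0) in
       a\<^sup>2 + majorant 1 f r
       + (1 + a * r) / ((1 + a) * (1 - r)) * norm0_sq f r
       + cmod (f (\<omega> z) - taylor_coeff f 0))"

definition zeta_root :: "nat \<Rightarrow> real" where
  "zeta_root m = (THE r. r \<in> {0<..1/3} \<and> r ^ m * (3 - 5 * r) + 3 * r - 1 = 0)"

definition eta_root :: "nat \<Rightarrow> real" where
  "eta_root m = (THE r. r \<in> {0<..1/2} \<and> r ^ m * (2 - 3 * r) + 2 * r - 1 = 0)"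

end

theory Submission
  imports Defs
begin

text \<open>Write \<open>a = |a\<^sub>0|\<close> and \<open>E(r) = r/(1 - r) + r\<^sup>m/(1 - r\<^sup>m)\<close>. Everything follows from the single estimate
  \<open>B\<^sub>1(f,r) + (1 + ar)/((1 + a)(1 - r)) \<parallel>f\<^sub>0\<parallel>\<^sup>2 + |f(\<omega>(z)) - a\<^sub>0| \<le> (1 - a\<^sup>2) E(r)\<close>,
  together with the facts that \<open>E\<close> increases strictly on \<open>[0,1)\<close> and that the two polynomial equations of the
  theorem are \<open>E(r) = 1/2\<close> and \<open>E(r) = 1\<close>. If \<open>E(r)\<close> is at most \<open>1/2\<close> or \<open>1\<close>, the quantity
  \<open>a + (1 - a\<^sup>2) E(r)\<close> or \<open>a\<^sup>2 + (1 - a\<^sup>2) E(r)\<close>, respectively, is at most \<open>1\<close>.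

  The estimate has two parts. The first two summands are at most \<open>(1 - a\<^sup>2) r/(1 - r)\<close>
  (lemma \<open>refined_bohr\<close>). This is obtained by summing Carlson's bounds for the coefficients \<open>a\<^sub>2\<^sub>n\<close>
  and \<open>a\<^sub>2\<^sub>n\<^sub>+\<^sub>1\<close> in terms of \<open>a\<^sub>0, \<dots>, a\<^sub>n\<close> (\<open>even_coeff_bound\<close>, \<open>odd_coeff_bound\<close>). Carlson's
  bounds in turn express that the lower triangular Toeplitz matrix of the Taylor coefficients is a
  contraction (\<open>toeplitz_contraction\<close>), tested on suitable vectors. For the last summand,
  \<open>|f(w) - a\<^sub>0| \<le> B\<^sub>1(f,|w|) \<le> (1 - a\<^sup>2) |w|/(1 - |w|)\<close> and \<open>|\<omega>(z)| \<le> |z|\<^sup>m\<close> by the iterated Schwarz lemma.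

  The radii are sharp because of \<open>f(z) = (a - z)/(1 - az)\<close> and \<open>\<omega>(z) = z\<^sup>m\<close>: for these the left-hand side at
  \<open>z = r\<close> is at least \<open>(1 - a\<^sup>2) (r/(1 - ar) + r\<^sup>m/(1 - ar\<^sup>m))\<close>, and the second factor tends to \<open>E(r)\<close> as
  \<open>a\<close> increases to \<open>1\<close> (\<open>bohr_functional_sharp\<close>).\<close>

section \<open>The Toeplitz matrix of the coefficients is a contraction\<close>

text \<open>The path \<open>circlepath 0 \<rho>\<close> runs once around the circle on \<open>{0..1}\<close> with constant speed, so integrals
  over \<open>{0..1}\<close> along it are means over the circle.\<close>

lemma coeff_circle_mean:
  fixes g :: "complex \<Rightarrow> complex" and \<rho> :: real
  assumes g: "g holomorphic_on unit_disc" and \<rho>: "0 < \<rho>" "\<rho> < 1"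
  shows "((\<lambda>t. g (circlepath 0 \<rho> t) / circlepath 0 \<rho> t ^ k) has_integral taylor_coeff g k) {0..1}"
proof -
  let ?c = "circlepath 0 \<rho>"
  have sub: "cball 0 \<rho> \<subseteq> unit_disc" using \<rho> by auto
  have "((\<lambda>u. g u / (u - 0) ^ Suc k) has_contour_integral
          ((2 * pi * \<i>) / fact k * (deriv ^^ k) g 0)) ?c"
  proof (rule Cauchy_has_contour_integral_higher_derivative_circlepath)
    show "continuous_on (cball 0 \<rho>) g"
      using g sub by (meson holomorphic_on_imp_continuous_on holomorphic_on_subset)
    show "g holomorphic_on ball 0 \<rho>"
      using g sub by (meson ball_subset_cball holomorphic_on_subset order_trans)
  qed (use \<rho> in auto)
  then have "((\<lambda>t. g (?c t) / ?c t ^ Suc k * vector_derivative ?c (at t within {0..1}))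
      has_integral (2 * pi * \<i>) / fact k * (deriv ^^ k) g 0) {0..1}"
    by (simp add: has_contour_integral_def)
  from has_integral_mult_right[OF this, of "1 / (2 * pi * \<i>)"]
  have "((\<lambda>t. 1 / (2 * pi * \<i>) * (g (?c t) / ?c t ^ Suc k * vector_derivative ?c (at t within {0..1})))
      has_integral taylor_coeff g k) {0..1}"
    by (simp add: fps_expansion_def)
  then show ?thesis
  proof (rule has_integral_eq[rotated])
    fix t :: real assume t: "t \<in> {0..1}"
    have nz: "?c t \<noteq> 0" using \<rho> by (simp add: circlepath)
    have "vector_derivative ?c (at t within {0..1}) = 2 * pi * \<i> * ?c t"
      using t by (subst vector_derivative_circlepath01) (auto simp: circlepath)
    then show "1 / (2 * pi * \<i>) * (g (?c t) / ?c t ^ Suc k * vector_derivative ?c (at t within {0..1}))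
        = g (?c t) / ?c t ^ k"
      using nz by simp
  qed
qed

text \<open>On the circle of radius \<open>\<rho>\<close> the conjugate of \<open>z\<^sup>k\<close> is \<open>\<rho>\<^sup>2\<^sup>k / z\<^sup>k\<close>, so the preceding lemma evaluates the
  \<open>L\<^sup>2\<close> inner product of \<open>g\<close> with a polynomial.\<close>

lemma polynomial_pairing:
  fixes g :: "complex \<Rightarrow> complex" and y :: "nat \<Rightarrow> complex" and \<rho> :: real
  assumes g: "g holomorphic_on unit_disc" and \<rho>: "0 < \<rho>" "\<rho> < 1"
  shows "((\<lambda>t. cnj (\<Sum>k\<le>N. y k * circlepath 0 \<rho> t ^ k) * g (circlepath 0 \<rho> t))
    has_integral (\<Sum>k\<le>N. cnj (y k) * of_real (\<rho> ^ (2 * k)) * taylor_coeff g k)) {0..1}"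
proof -
  let ?c = "circlepath 0 \<rho>"
  have "((\<lambda>t. \<Sum>k\<le>N. cnj (y k) * of_real (\<rho> ^ (2 * k)) * (g (?c t) / ?c t ^ k))
    has_integral (\<Sum>k\<le>N. cnj (y k) * of_real (\<rho> ^ (2 * k)) * taylor_coeff g k)) {0..1}"
    by (intro has_integral_sum has_integral_mult_right coeff_circle_mean assms) auto
  moreover have "cnj (\<Sum>k\<le>N. y k * ?c t ^ k) * g (?c t)
      = (\<Sum>k\<le>N. cnj (y k) * of_real (\<rho> ^ (2 * k)) * (g (?c t) / ?c t ^ k))" for t
  proof -
    have nz: "?c t \<noteq> 0" using \<rho> by (simp add: circlepath)
    have "cmod (?c t) = \<rho>"
      using \<rho> by (simp add: circlepath norm_mult)
    then have "?c t * cnj (?c t) = of_real (\<rho>\<^sup>2)"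
      by (metis complex_norm_square)
    then have "cnj (?c t) ^ k * ?c t ^ k = of_real (\<rho> ^ (2 * k))" for k
      by (metis mult.commute of_real_power power_mult power_mult_distrib)
    then have *: "cnj (?c t) ^ k = of_real (\<rho> ^ (2 * k)) / ?c t ^ k" for k
      using nz by (simp add: eq_divide_eq)
    show ?thesis
      by (simp add: cnj_sum sum_distrib_right * mult.assoc)
  qed
  ultimately show ?thesis by simp
qed

lemma bounded_class_holomorphic: "f \<in> bounded_class \<Longrightarrow> f holomorphic_on unit_disc"
  by (simp add: bounded_class_def analytic_on_open)

text \<open>Multiplication by \<open>f\<close> does not increase absolute values on a circle. Applied to polynomials with
  coefficients \<open>x\<close> and \<open>y\<close>, this says that the form \<open>\<langle>y, Tx\<rangle>\<close> of the truncated Toeplitz matrix \<open>T\<close> of \<open>f\<close>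
  satisfies \<open>Re \<langle>y, Tx\<rangle> \<le> (|x|\<^sup>2 + |y|\<^sup>2)/2\<close>. The circles have radius below \<open>1\<close>; the claim is the limit as
  the radius tends to \<open>1\<close>.\<close>

lemma toeplitz_contraction:
  fixes f :: "complex \<Rightarrow> complex" and x y :: "nat \<Rightarrow> complex"
  assumes f: "f \<in> bounded_class"
  shows "Re (\<Sum>k\<le>N. cnj (y k) * (\<Sum>j\<le>k. taylor_coeff f (k - j) * x j))
    \<le> ((\<Sum>k\<le>N. (cmod (x k))\<^sup>2) + (\<Sum>k\<le>N. (cmod (y k))\<^sup>2)) / 2"
proof -
  define X where "X z = (\<Sum>j\<le>N. x j * z ^ j)" for z :: complex
  define Y where "Y z = (\<Sum>j\<le>N. y j * z ^ j)" for z :: complex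
  define P where "P x = Abs_fps (\<lambda>j. if j \<le> N then x j else 0)" for x :: "nat \<Rightarrow> complex"
  have P: "(\<lambda>z. \<Sum>j\<le>N. x j * z ^ j) has_fps_expansion P x" for x
  proof -
    have "(\<lambda>z. \<Sum>j\<le>N. x j * z ^ j) has_fps_expansion (\<Sum>j\<le>N. fps_const (x j) * fps_X ^ j)"
      by (intro fps_expansion_intros)
    also have "(\<Sum>j\<le>N. fps_const (x j) * fps_X ^ j) = P x"
      by (rule fps_ext) (auto simp: P_def fps_sum_nth fps_X_power_nth if_distrib cong: if_cong)
    finally show ?thesis .
  qed
  have holf: "f holomorphic_on unit_disc" using f by (rule bounded_class_holomorphic)
  have holX: "X holomorphic_on unit_disc" and holY: "Y holomorphic_on unit_disc"
    unfolding X_def[abs_def] Y_def[abs_def] by (intro holomorphic_intros)+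
  have fF: "f has_fps_expansion fps_expansion f 0"
    by (rule has_fps_expansion_fps_expansion[OF _ _ holf]) auto
  have coefX: "taylor_coeff X k = x k" if "k \<le> N" for k
    using fps_expansion_eqI[OF P[of x, folded X_def[abs_def]]] that
    by (simp add: X_def[abs_def] P_def)
  have coefY: "taylor_coeff Y k = y k" if "k \<le> N" for k
    using fps_expansion_eqI[OF P[of y]] that
    by (simp add: Y_def[abs_def] P_def)
  have coefP: "taylor_coeff (\<lambda>z. f z * X z) k = (\<Sum>j\<le>k. taylor_coeff f (k - j) * x j)"
    if "k \<le> N" for k
  proof -
    have "fps_expansion (\<lambda>z. f z * X z) 0 = P x * fps_expansion f 0"
      using fps_expansion_eqI[OF has_fps_expansion_mult[OF fF P[of x]]]
      by (simp add: X_def mult.commute)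
    then have "taylor_coeff (\<lambda>z. f z * X z) k = (\<Sum>j=0..k. fps_nth (P x) j * taylor_coeff f (k - j))"
      by (simp only: fps_mult_nth)
    also have "\<dots> = (\<Sum>j\<le>k. taylor_coeff f (k - j) * x j)"
      using that by (intro sum.cong) (auto simp: P_def)
    finally show ?thesis .
  qed
  let ?L = "\<lambda>\<rho>::real. Re (\<Sum>k\<le>N. cnj (y k) * of_real (\<rho> ^ (2 * k)) * (\<Sum>j\<le>k. taylor_coeff f (k - j) * x j))"
  let ?R = "\<lambda>\<rho>::real. ((\<Sum>k\<le>N. \<rho> ^ (2 * k) * (cmod (x k))\<^sup>2) + (\<Sum>k\<le>N. \<rho> ^ (2 * k) * (cmod (y k))\<^sup>2)) / 2"
  have le: "?L \<rho> \<le> ?R \<rho>" if \<rho>: "0 < \<rho>" "\<rho> < 1" for \<rho>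
  proof -
    let ?c = "circlepath 0 \<rho>"
    have "((\<lambda>t. cnj (Y (?c t)) * (f (?c t) * X (?c t))) has_integral
       (\<Sum>k\<le>N. cnj (y k) * of_real (\<rho> ^ (2 * k)) * taylor_coeff (\<lambda>z. f z * X z) k)) {0..1}"
      unfolding Y_def
      by (rule polynomial_pairing) (intro holomorphic_intros holf holX \<rho>)+
    from has_integral_linear[OF this bounded_linear_Re]
    have 1: "((\<lambda>t. Re (cnj (Y (?c t)) * (f (?c t) * X (?c t)))) has_integral ?L \<rho>) {0..1}"
      using coefP by (simp add: o_def)
    have sq: "((\<lambda>t. (cmod (W (?c t)))\<^sup>2) has_integral (\<Sum>k\<le>N. \<rho> ^ (2 * k) * (cmod (w k))\<^sup>2)) {0..1}"
      if "\<And>z. W z = (\<Sum>j\<le>N. w j * z ^ j)" "W holomorphic_on unit_disc"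
        "\<And>k. k \<le> N \<Longrightarrow> taylor_coeff W k = w k" for W w
    proof -
      have "((\<lambda>t. cnj (W (?c t)) * W (?c t)) has_integral
       (\<Sum>k\<le>N. cnj (w k) * of_real (\<rho> ^ (2 * k)) * taylor_coeff W k)) {0..1}"
        using polynomial_pairing[OF that(2) \<rho>, where N = N and y = w] by (simp add: that(1))
      from has_integral_linear[OF this bounded_linear_Re]
      have "((\<lambda>t. Re (cnj (W (?c t)) * W (?c t))) has_integral
       (\<Sum>k\<le>N. Re (cnj (w k) * of_real (\<rho> ^ (2 * k)) * w k))) {0..1}"
        using that(3) by (simp add: o_def)
      moreover have "Re (cnj w * w) = (cmod w)\<^sup>2" for w
        unfolding cmod_power2 by (simp add: power2_eq_square)
      moreover have "Re (cnj w * of_real a * w) = a * (cmod w)\<^sup>2" for w a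
        unfolding cmod_power2 by (simp add: power2_eq_square algebra_simps)
      ultimately show ?thesis by (simp only:)
    qed
    have "((\<lambda>t. ((cmod (X (?c t)))\<^sup>2 + (cmod (Y (?c t)))\<^sup>2) / 2) has_integral ?R \<rho>) {0..1}"
      by (intro has_integral_divide has_integral_add sq X_def Y_def holX holY coefX coefY)
    then show ?thesis
    proof (rule has_integral_le[OF 1])
      fix t :: real
      have "cmod (?c t) = \<rho>" using \<rho> by (simp add: circlepath norm_mult)
      then have "cmod (f (?c t)) \<le> 1"
        using f \<rho> by (auto simp: bounded_class_def)
      then have "cmod (Y (?c t)) * (cmod (f (?c t)) * cmod (X (?c t))) \<le> cmod (Y (?c t)) * cmod (X (?c t))"
        by (intro mult_left_mono mult_left_le_one_le) auto
      moreover have "Re (cnj (Y (?c t)) * (f (?c t) * X (?c t))) \<le> cmod (Y (?c t)) * (cmod (f (?c t)) * cmod (X (?c t)))"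
        by (rule order_trans[OF complex_Re_le_cmod]) (simp add: norm_mult)
      ultimately show "Re (cnj (Y (?c t)) * (f (?c t) * X (?c t))) \<le> ((cmod (X (?c t)))\<^sup>2 + (cmod (Y (?c t)))\<^sup>2) / 2"
        using sum_squares_bound[of "cmod (X (?c t))" "cmod (Y (?c t))"] by (simp add: algebra_simps)
    qed
  qed
  have "?L 1 \<le> ?R 1"
  proof (rule tendsto_le)
    show "(?L \<longlongrightarrow> ?L 1) (at_left 1)" by (intro tendsto_intros) 
    show "(?R \<longlongrightarrow> ?R 1) (at_left 1)" by (intro tendsto_intros) auto
    show "\<forall>\<^sub>F \<rho> in at_left 1. ?L \<rho> \<le> ?R \<rho>"
      by (rule eventually_mono[OF eventually_at_left_real[of 0 1]], simp, rule le) auto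
  qed auto
  then show ?thesis by simp
qed

section \<open>Carlson's coefficient bounds\<close>

lemma obtain_phase:
  fixes c :: complex
  obtains \<phi> where "cmod \<phi> = 1" "cnj \<phi> * c = of_real (cmod c)"
proof (cases "c = 0")
  case True
  then show ?thesis using that[of 1] by simp
next
  case False
  show ?thesis
  proof (rule that[of "sgn c"])
    show "cmod (sgn c) = 1" using False by (simp add: norm_sgn)
    have "cnj c * c = of_real (cmod c) * of_real (cmod c)"
      using complex_norm_square[of c] by (simp add: power2_eq_square mult.commute)
    then show "cnj (sgn c) * c = of_real (cmod c)"
      using False by (simp add: sgn_eq field_simps)
  qed
qed

text \<open>The bound comes from \<open>toeplitz_contraction\<close> for the matrix of size \<open>2n + 1\<close>. Below the index \<open>n\<close> the
  vector \<open>y\<close> copies the first column, and above it \<open>x\<close> copies the conjugated last row up to the factor \<open>\<phi>\<close>.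
  With the entries \<open>x\<^sub>0 = 1\<close> and \<open>y\<^sub>2\<^sub>n = \<phi>\<close> this produces \<open>|a\<^sub>2\<^sub>n| + 2s\<close>, where \<open>s = \<Sum>\<^bsub>k<n\<^esub> |a\<^sub>k|\<^sup>2\<close>;
  entries of modulus \<open>t\<close> at the index \<open>n\<close> add at least
  \<open>2t|a\<^sub>n| - t\<^sup>2|a\<^sub>0|\<close>. The unimodular factors \<open>\<phi>\<close> and \<open>\<psi>\<close> rotate \<open>a\<^sub>2\<^sub>n\<close> and \<open>a\<^sub>n\<close> to the positive axis.\<close>

lemma even_coeff_bound:
  assumes f: "f \<in> bounded_class" and n: "n \<ge> 1"
  shows "cmod (taylor_coeff f (2 * n)) \<le>
    1 - (\<Sum>k<n. (cmod (taylor_coeff f k))\<^sup>2) - (cmod (taylor_coeff f n))\<^sup>2 / (1 + cmod (taylor_coeff f 0))"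
proof -
  define a where "a = taylor_coeff f"
  define s where "s = (\<Sum>k<n. (cmod (a k))\<^sup>2)"
  obtain \<phi> where \<phi>: "cmod \<phi> = 1" "cnj \<phi> * a (2 * n) = of_real (cmod (a (2 * n)))"
    by (rule obtain_phase)
  obtain \<psi> where \<psi>: "cmod \<psi> = 1" "cnj \<psi> * a n = of_real (cmod (a n))"
    by (rule obtain_phase)
  have \<phi>\<phi>: "cnj \<phi> * \<phi> = 1"
    using \<phi>(1) complex_norm_square[of \<phi>] by (simp add: mult.commute)
  \<comment> \<open>this \<open>t\<close> maximises \<open>2t|a\<^sub>n| - t\<^sup>2(1 + |a\<^sub>0|)\<close>\<close>
  define t where "t = cmod (a n) / (1 + cmod (a 0))"
  define x where "x j = (if j = 0 then 1 else if j < n then 0 else if j = n then of_real t * \<phi> * cnj \<psi>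
      else \<phi> * cnj (a (2 * n - j)))" for j
  define y where "y k = (if k < n then a k else if k = n then of_real t * \<psi> else if k = 2 * n then \<phi> else 0)" for k
  let ?T = "\<lambda>k. \<Sum>j\<le>k. a (k - j) * x j"
  have split: "sum g {..2 * n} = sum g {..<n} + g n + sum g {n<..<2 * n} + g (2 * n)"
    for g :: "nat \<Rightarrow> 'b::comm_monoid_add"
  proof -
    have "{..2 * n} = {..<n} \<union> {n} \<union> {n<..<2 * n} \<union> {2 * n}" using n by auto
    moreover have "sum g ({..<n} \<union> {n<..<2 * n}) = sum g {..<n} + sum g {n<..<2 * n}"
      by (rule sum.union_disjoint) auto
    ultimately show ?thesis using n by (simp add: add_ac)
  qed
  have split': "sum g {..<n} = g 0 + sum g {0<..<n}" for g :: "nat \<Rightarrow> 'b::comm_monoid_add"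
  proof -
    have "{..<n} = insert 0 {0<..<n}" using n by auto
    then show ?thesis by simp
  qed
  have split'': "sum g {..k} = sum g {..<k} + g k" for g :: "nat \<Rightarrow> 'b::comm_monoid_add" and k
    by (simp add: lessThan_Suc_atMost[symmetric])
  have reflect: "sum (\<lambda>j. h (2 * n - j)) {n<..<2 * n} + h 0 = sum h {..<n}" for h :: "nat \<Rightarrow> 'b::comm_monoid_add"
  proof -
    have "sum (\<lambda>j. h (2 * n - j)) {n<..<2 * n} = sum h {0<..<n}"
      by (rule sum.reindex_bij_witness[of _ "\<lambda>j. 2 * n - j" "\<lambda>j. 2 * n - j"]) auto
    then show ?thesis by (simp add: split' add.commute)
  qed
  have T_low: "?T k = a k" if "k < n" for k
  proof -
    have "?T k = (\<Sum>j\<in>{0}. a (k - j) * x j)"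
      using that by (intro sum.mono_neutral_right) (auto simp: x_def)
    then show ?thesis by (simp add: x_def)
  qed
  have x_vals: "x 0 = 1" "x n = of_real t * \<phi> * cnj \<psi>" "x (2 * n) = \<phi> * cnj (a 0)"
    using n by (simp_all add: x_def)
  have y_vals: "y n = of_real t * \<psi>" "y (2 * n) = \<phi>"
    using n by (simp_all add: y_def)
  have x_gap: "(\<Sum>j\<in>{0<..<n}. a (k - j) * x j) = 0" for k
    by (rule sum.neutral) (auto simp: x_def)
  have T_mid: "?T n = a n + a 0 * (of_real t * \<phi> * cnj \<psi>)"
    unfolding split''[of _ n] split' x_gap x_vals by simp
  have T_top: "?T (2 * n) = a (2 * n) + a n * (of_real t * \<phi> * cnj \<psi>) + \<phi> * of_real s"
  proof -
    have "(\<Sum>j\<in>{n<..<2 * n}. a (2 * n - j) * x j)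
        = (\<Sum>j\<in>{n<..<2 * n}. a (2 * n - j) * (\<phi> * cnj (a (2 * n - j))))"
      by (intro sum.cong) (auto simp: x_def)
    then have "?T (2 * n) = a (2 * n) + a n * (of_real t * \<phi> * cnj \<psi>)
        + ((\<Sum>j\<in>{n<..<2 * n}. a (2 * n - j) * (\<phi> * cnj (a (2 * n - j)))) + a 0 * (\<phi> * cnj (a 0)))"
      unfolding split split' x_gap x_vals by simp
    also have "\<dots> = a (2 * n) + a n * (of_real t * \<phi> * cnj \<psi>) + (\<Sum>i<n. a i * (\<phi> * cnj (a i)))"
      using reflect[of "\<lambda>i. a i * (\<phi> * cnj (a i))"] by simp
    also have "(\<Sum>i<n. a i * (\<phi> * cnj (a i))) = \<phi> * of_real s"
      unfolding s_def of_real_sum sum_distrib_left complex_norm_square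
      by (intro sum.cong) simp_all
    finally show ?thesis .
  qed
  have y_low: "(\<Sum>k<n. cnj (y k) * ?T k) = of_real s"
    unfolding s_def of_real_sum complex_norm_square
    by (intro sum.cong) (use T_low in \<open>simp_all add: y_def\<close>)
  have "(\<Sum>k\<le>2 * n. cnj (y k) * ?T k) = (\<Sum>k<n. cnj (y k) * ?T k) + cnj (y n) * ?T n
      + (\<Sum>k\<in>{n<..<2 * n}. cnj (y k) * ?T k) + cnj (y (2 * n)) * ?T (2 * n)"
    by (rule split)
  also have "(\<Sum>k\<in>{n<..<2 * n}. cnj (y k) * ?T k) = 0"
    by (rule sum.neutral) (auto simp: y_def)
  also have "(\<Sum>k<n. cnj (y k) * ?T k) + cnj (y n) * ?T n + 0 + cnj (y (2 * n)) * ?T (2 * n)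
      = of_real s + of_real t * (cnj \<psi> * a n) + of_real (t\<^sup>2) * (a 0 * \<phi> * (cnj \<psi>)\<^sup>2)
        + (cnj \<phi> * a (2 * n) + of_real t * (cnj \<psi> * a n) * (cnj \<phi> * \<phi>) + of_real s * (cnj \<phi> * \<phi>))"
    unfolding y_low T_mid T_top y_vals by (simp add: algebra_simps power2_eq_square)
  also have "\<dots> = of_real (2 * s + 2 * t * cmod (a n) + cmod (a (2 * n))) + of_real (t\<^sup>2) * (a 0 * \<phi> * (cnj \<psi>)\<^sup>2)"
    unfolding \<phi>\<phi> \<phi>(2) \<psi>(2) by simp
  finally have form: "(\<Sum>k\<le>2 * n. cnj (y k) * ?T k) = \<dots>" .
  have low: "- (t\<^sup>2 * cmod (a 0)) \<le> Re (of_real (t\<^sup>2) * (a 0 * \<phi> * (cnj \<psi>)\<^sup>2))"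
    using abs_Re_le_cmod[of "of_real (t\<^sup>2) * (a 0 * \<phi> * (cnj \<psi>)\<^sup>2)"] \<phi>(1) \<psi>(1)
    by (simp add: norm_mult norm_power del: of_real_power)
  have nx: "(\<Sum>k\<le>2 * n. (cmod (x k))\<^sup>2) = 1 + t\<^sup>2 + s"
  proof -
    have "(\<Sum>k\<in>{n<..<2 * n}. (cmod (x k))\<^sup>2) = (\<Sum>k\<in>{n<..<2 * n}. (cmod (a (2 * n - k)))\<^sup>2)"
      using \<phi>(1) by (intro sum.cong) (auto simp: x_def norm_mult)
    moreover have "(\<Sum>k\<in>{0<..<n}. (cmod (x k))\<^sup>2) = 0"
      by (rule sum.neutral) (auto simp: x_def)
    ultimately have "(\<Sum>k\<le>2 * n. (cmod (x k))\<^sup>2) = 1 + t\<^sup>2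
        + ((\<Sum>k\<in>{n<..<2 * n}. (cmod (a (2 * n - k)))\<^sup>2) + (cmod (a 0))\<^sup>2)"
      using \<phi>(1) \<psi>(1) unfolding split split' x_vals by (simp add: norm_mult power_mult_distrib)
    then show ?thesis using reflect[of "\<lambda>i. (cmod (a i))\<^sup>2"] by (simp add: s_def)
  qed
  have ny: "(\<Sum>k\<le>2 * n. (cmod (y k))\<^sup>2) = s + t\<^sup>2 + 1"
  proof -
    have "(\<Sum>k\<in>{n<..<2 * n}. (cmod (y k))\<^sup>2) = 0"
      by (rule sum.neutral) (auto simp: y_def)
    moreover have "(\<Sum>k<n. (cmod (y k))\<^sup>2) = s"
      unfolding s_def by (intro sum.cong) (auto simp: y_def)
    ultimately show ?thesis
      using \<phi>(1) \<psi>(1) unfolding split y_vals by (simp add: norm_mult power_mult_distrib)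
  qed
  have "2 * s + 2 * t * cmod (a n) + cmod (a (2 * n)) - t\<^sup>2 * cmod (a 0) \<le> Re (\<Sum>k\<le>2 * n. cnj (y k) * ?T k)"
    unfolding form using low by (simp del: of_real_power of_real_add of_real_mult)
  also have "\<dots> \<le> 1 + t\<^sup>2 + s"
    using toeplitz_contraction[OF f, where N = "2 * n" and x = x and y = y] by (simp add: nx ny flip: a_def)
  finally have "cmod (a (2 * n)) \<le> 1 - s - (2 * t * cmod (a n) - t\<^sup>2 * (1 + cmod (a 0)))"
    by (simp add: algebra_simps)
  moreover have "2 * t * cmod (a n) - t\<^sup>2 * (1 + cmod (a 0)) = (cmod (a n))\<^sup>2 / (1 + cmod (a 0))"
  proof -
    have "1 + cmod (a 0) > 0" by (simp add: add_pos_nonneg)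
    then have "t * (1 + cmod (a 0)) = cmod (a n)" by (simp add: t_def)
    then have "t\<^sup>2 * (1 + cmod (a 0)) = t * cmod (a n)" by (simp add: power2_eq_square mult.assoc)
    moreover have "(cmod (a n))\<^sup>2 / (1 + cmod (a 0)) = t * cmod (a n)"
      by (simp add: t_def power2_eq_square)
    ultimately show ?thesis by simp
  qed
  ultimately show ?thesis by (simp add: s_def a_def)
qed

text \<open>The function \<open>z f(z)\<close> is again bounded by \<open>1\<close>, and its coefficient of index \<open>2n + 2\<close> is \<open>a\<^sub>2\<^sub>n\<^sub>+\<^sub>1\<close>.
  The bound for even indices applies to it; as its constant term is \<open>0\<close>, the middle coefficient
  \<open>a\<^sub>n\<close> contributes its full square.\<close>

lemma odd_coeff_bound:
  assumes f: "f \<in> bounded_class"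
  shows "cmod (taylor_coeff f (2 * n + 1)) \<le> 1 - (\<Sum>k\<le>n. (cmod (taylor_coeff f k))\<^sup>2)"
proof -
  define g where "g z = z * f z" for z
  have hol: "f holomorphic_on unit_disc" using f by (rule bounded_class_holomorphic)
  have "g holomorphic_on unit_disc"
    unfolding g_def[abs_def] by (intro holomorphic_intros hol)
  moreover have "cmod (g z) \<le> 1" if "z \<in> unit_disc" for z
    using that f by (auto simp: g_def norm_mult bounded_class_def intro!: mult_le_one)
  ultimately have g: "g \<in> bounded_class"
    by (simp add: bounded_class_def analytic_on_open)
  have "f has_fps_expansion fps_expansion f 0"
    by (rule has_fps_expansion_fps_expansion[OF _ _ hol]) auto
  then have "g has_fps_expansion fps_X * fps_expansion f 0"
    unfolding g_def[abs_def] by (intro fps_expansion_intros)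
  then have "fps_expansion g 0 = fps_X * fps_expansion f 0"
    by (rule fps_expansion_eqI)
  then have c: "taylor_coeff g k = (if k = 0 then 0 else taylor_coeff f (k - 1))" for k
    by simp
  have "(\<Sum>k<Suc n. (cmod (taylor_coeff g k))\<^sup>2) = (\<Sum>k<n. (cmod (taylor_coeff f k))\<^sup>2)"
    unfolding sum.lessThan_Suc_shift by (simp add: c)
  then show ?thesis
    using even_coeff_bound[OF g, of "Suc n"] by (simp add: c lessThan_Suc_atMost[symmetric])
qed

lemma coeff_le_one: "f \<in> bounded_class \<Longrightarrow> cmod (taylor_coeff f n) \<le> 1"
proof -
  assume f: "f \<in> bounded_class"
  have "(cmod (taylor_coeff f n))\<^sup>2 \<le> (\<Sum>k\<le>n. (cmod (taylor_coeff f k))\<^sup>2)"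
    by (rule member_le_sum) auto
  also have "\<dots> \<le> 1"
    using odd_coeff_bound[OF f, of n] norm_ge_zero[of "taylor_coeff f (2 * n + 1)"] by linarith
  finally show ?thesis by (simp add: abs_square_le_1)
qed

section \<open>A refined Bohr inequality\<close>

text \<open>The induction on \<open>M\<close> needs the subtracted term on the right. Adding the bounds for
  \<open>a\<^sub>2\<^sub>M\<^sub>+\<^sub>1\<close> and \<open>a\<^sub>2\<^sub>M\<^sub>+\<^sub>2\<close>, weighted by powers of \<open>r\<close>, and the new term of
  the weighted square sum gives exactly its change from \<open>M\<close> to \<open>M + 1\<close>, because
  \<open>(1 + ar)/((1 + a)(1 - r)) = 1/(1 + a) + r/(1 - r)\<close>.\<close>

lemma refined_bohr_partial:
  assumes f: "f \<in> bounded_class" and r: "0 \<le> r" "r < 1"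
  defines "b \<equiv> \<lambda>n. cmod (taylor_coeff f n)"
  shows "(\<Sum>n<2 * M. b (n + 1) * r ^ (n + 1))
      + (1 + b 0 * r) / ((1 + b 0) * (1 - r)) * (\<Sum>n<M. (b (n + 1))\<^sup>2 * r ^ (2 * (n + 1)))
    \<le> (1 - (b 0)\<^sup>2) * (r / (1 - r)) - (1 - (\<Sum>k\<le>M. (b k)\<^sup>2)) * (r ^ (2 * M + 1) / (1 - r))"
proof (induction M)
  case 0
  then show ?case by simp
next
  case (Suc M)
  define K where "K = (1 + b 0 * r) / ((1 + b 0) * (1 - r))"
  define S where "S = (\<Sum>k\<le>M. (b k)\<^sup>2)"
  define q where "q = r ^ (2 * M)"
  have q: "q \<ge> 0" using r by (simp add: q_def)
  have b0: "1 + b 0 > 0" by (simp add: b_def add_pos_nonneg)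
  have K: "K = 1 / (1 + b 0) + r / (1 - r)"
    using b0 r by (simp add: K_def field_simps)
  have odd: "b (2 * M + 1) \<le> 1 - S"
    using odd_coeff_bound[OF f] by (simp add: b_def S_def)
  have even: "b (2 * M + 2) \<le> 1 - S - (b (M + 1))\<^sup>2 / (1 + b 0)"
    using even_coeff_bound[OF f, of "M + 1"] by (simp add: b_def S_def lessThan_Suc_atMost)
  have "b (2 * M + 1) * (q * r) + b (2 * M + 2) * (q * r\<^sup>2) + K * ((b (M + 1))\<^sup>2 * (q * r\<^sup>2))
      \<le> (1 - S) * (q * r) + (1 - S - (b (M + 1))\<^sup>2 / (1 + b 0)) * (q * r\<^sup>2) + K * ((b (M + 1))\<^sup>2 * (q * r\<^sup>2))"
    using q r by (intro add_mono mult_right_mono odd even order_refl) auto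
  also have "\<dots> = (1 - S) * (q * r / (1 - r)) - (1 - (S + (b (M + 1))\<^sup>2)) * (q * r ^ 3 / (1 - r))"
  proof -
    have 1: "q * r / (1 - r) = q * r + q * r\<^sup>2 + q * r ^ 3 / (1 - r)"
      using r by (simp add: field_simps power2_eq_square power3_eq_cube)
    have 2: "K * ((b (M + 1))\<^sup>2 * (q * r\<^sup>2))
        = (b (M + 1))\<^sup>2 / (1 + b 0) * (q * r\<^sup>2) + (b (M + 1))\<^sup>2 * (q * r ^ 3 / (1 - r))"
      unfolding K by (simp add: distrib_right power2_eq_square power3_eq_cube)
    show ?thesis
      unfolding 1 2 left_diff_distrib distrib_left distrib_right by linarith
  qed
  finally have step: "b (2 * M + 1) * (q * r) + b (2 * M + 2) * (q * r\<^sup>2) + K * ((b (M + 1))\<^sup>2 * (q * r\<^sup>2))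
      \<le> (1 - S) * (q * r / (1 - r)) - (1 - (S + (b (M + 1))\<^sup>2)) * (q * r ^ 3 / (1 - r))" .
  have sum1: "(\<Sum>n<2 * Suc M. b (n + 1) * r ^ (n + 1))
      = (\<Sum>n<2 * M. b (n + 1) * r ^ (n + 1)) + b (2 * M + 1) * (q * r) + b (2 * M + 2) * (q * r\<^sup>2)"
    by (simp add: q_def power2_eq_square mult_ac)
  have sum2: "(\<Sum>n<Suc M. (b (n + 1))\<^sup>2 * r ^ (2 * (n + 1)))
      = (\<Sum>n<M. (b (n + 1))\<^sup>2 * r ^ (2 * (n + 1))) + (b (M + 1))\<^sup>2 * (q * r\<^sup>2)"
    by (simp add: q_def power2_eq_square mult_ac)
  have sum3: "(\<Sum>k\<le>Suc M. (b k)\<^sup>2) = S + (b (M + 1))\<^sup>2"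
    by (simp add: S_def)
  have pow: "r ^ (2 * M + 1) = q * r" "r ^ (2 * Suc M + 1) = q * r ^ 3"
    by (simp_all add: q_def power3_eq_cube mult_ac)
  show ?case
    using Suc.IH step
    unfolding sum1 sum2 sum3 pow K_def[symmetric] S_def[symmetric] distrib_left[of K] by linarith
qed

lemma summable_majorant:
  assumes f: "f \<in> bounded_class" and r: "0 \<le> r" "r < 1"
  shows "summable (\<lambda>n. cmod (taylor_coeff f (n + k)) * r ^ (n + k))"
proof (rule summable_comparison_test'[where N = 0])
  show "summable (\<lambda>n. r ^ n)" using r by (simp add: summable_geometric)
  fix n :: nat
  have "cmod (taylor_coeff f (n + k)) * r ^ (n + k) \<le> 1 * r ^ n"
    using r by (intro mult_mono coeff_le_one[OF f] power_decreasing) auto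
  then show "norm (cmod (taylor_coeff f (n + k)) * r ^ (n + k)) \<le> r ^ n"
    using r by simp
qed

lemma summable_norm0_sq:
  assumes f: "f \<in> bounded_class" and r: "0 \<le> r" "r < 1"
  shows "summable (\<lambda>n. (cmod (taylor_coeff f (n + 1)))\<^sup>2 * r ^ (2 * (n + 1)))"
proof (rule summable_comparison_test'[where N = 0])
  show "summable (\<lambda>n. r ^ n)" using r by (simp add: summable_geometric)
  fix n :: nat
  have "(cmod (taylor_coeff f (n + 1)))\<^sup>2 * r ^ (2 * (n + 1)) \<le> 1 * r ^ n"
    using r coeff_le_one[OF f, of "n + 1"]
    by (intro mult_mono power_decreasing) (auto simp: abs_square_le_1)
  then show "norm ((cmod (taylor_coeff f (n + 1)))\<^sup>2 * r ^ (2 * (n + 1))) \<le> r ^ n"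
    using r by simp
qed

lemma norm0_sq_nonneg:
  assumes "f \<in> bounded_class" "0 \<le> r" "r < 1"
  shows "0 \<le> norm0_sq f r"
  unfolding norm0_sq_def by (intro suminf_nonneg summable_norm0_sq assms) (use assms in simp)

lemma majorant_0:
  assumes "f \<in> bounded_class" "0 \<le> r" "r < 1"
  shows "majorant 0 f r = cmod (taylor_coeff f 0) + majorant 1 f r"
  using suminf_split_head[OF summable_majorant[OF assms, of 0]] by (simp add: majorant_def)

lemma refined_bohr:
  assumes f: "f \<in> bounded_class" and r: "0 \<le> r" "r < 1"
  defines "a \<equiv> cmod (taylor_coeff f 0)"
  shows "majorant 1 f r + (1 + a * r) / ((1 + a) * (1 - r)) * norm0_sq f r \<le> (1 - a\<^sup>2) * (r / (1 - r))"
proof (rule LIMSEQ_le_const2)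
  let ?b = "\<lambda>n. cmod (taylor_coeff f n)"
  let ?s = "\<lambda>M. (\<Sum>n<2 * M. ?b (n + 1) * r ^ (n + 1))
      + (1 + a * r) / ((1 + a) * (1 - r)) * (\<Sum>n<M. (?b (n + 1))\<^sup>2 * r ^ (2 * (n + 1)))"
  have "(\<lambda>N. \<Sum>n<N. ?b (n + 1) * r ^ (n + 1)) \<longlonglongrightarrow> majorant 1 f r"
    unfolding majorant_def by (intro summable_LIMSEQ summable_majorant f r)
  from LIMSEQ_subseq_LIMSEQ[OF this, of "\<lambda>M. 2 * M"]
  have "(\<lambda>M. \<Sum>n<2 * M. ?b (n + 1) * r ^ (n + 1)) \<longlonglongrightarrow> majorant 1 f r"
    by (simp add: strict_mono_def o_def)
  moreover have "(\<lambda>M. \<Sum>n<M. (?b (n + 1))\<^sup>2 * r ^ (2 * (n + 1))) \<longlonglongrightarrow> norm0_sq f r"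
    unfolding norm0_sq_def by (intro summable_LIMSEQ summable_norm0_sq f r)
  ultimately show "?s \<longlonglongrightarrow> majorant 1 f r + (1 + a * r) / ((1 + a) * (1 - r)) * norm0_sq f r"
    by (intro tendsto_intros)
  show "\<exists>N. \<forall>M\<ge>N. ?s M \<le> (1 - a\<^sup>2) * (r / (1 - r))"
  proof (intro exI allI impI)
    fix M
    have "0 \<le> 1 - (\<Sum>k\<le>M. (?b k)\<^sup>2)"
      using odd_coeff_bound[OF f, of M] norm_ge_zero[of "taylor_coeff f (2 * M + 1)"] by linarith
    then have "0 \<le> (1 - (\<Sum>k\<le>M. (?b k)\<^sup>2)) * (r ^ (2 * M + 1) / (1 - r))"
      using r by (intro mult_nonneg_nonneg divide_nonneg_nonneg) auto
    then show "?s M \<le> (1 - a\<^sup>2) * (r / (1 - r))"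
      using refined_bohr_partial[OF f r, of M] unfolding a_def by linarith
  qed
qed

lemma dist_le_majorant:
  assumes f: "f \<in> bounded_class" and w: "cmod w < 1"
  shows "cmod (f w - taylor_coeff f 0) \<le> majorant 1 f (cmod w)"
proof -
  let ?h = "\<lambda>n. taylor_coeff f (n + 1) * w ^ (n + 1)"
  have "(\<lambda>n. taylor_coeff f n * w ^ n) sums f w"
    using holomorphic_power_series[OF bounded_class_holomorphic[OF f], of w] w
    by (simp add: fps_expansion_def)
  then have h: "?h sums (f w - taylor_coeff f 0)"
    by (subst (asm) sums_iff_shift'[of _ 1, symmetric]) simp
  have sm: "summable (\<lambda>n. norm (?h n))"
    using summable_majorant[OF f, of "cmod w" 1] w by (simp add: norm_mult norm_power)
  have "cmod (f w - taylor_coeff f 0) = norm (suminf ?h)"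
    using h by (simp add: sums_iff)
  also have "\<dots> \<le> (\<Sum>n. norm (?h n))" by (rule summable_norm[OF sm])
  also have "\<dots> = majorant 1 f (cmod w)" by (simp add: majorant_def norm_mult norm_power)
  finally show ?thesis .
qed

lemma dist_bound:
  assumes f: "f \<in> bounded_class" and w: "cmod w < 1"
  shows "cmod (f w - taylor_coeff f 0) \<le> (1 - (cmod (taylor_coeff f 0))\<^sup>2) * (cmod w / (1 - cmod w))"
proof -
  have "0 \<le> (1 + cmod (taylor_coeff f 0) * cmod w) / ((1 + cmod (taylor_coeff f 0)) * (1 - cmod w)) * norm0_sq f (cmod w)"
    using w by (intro mult_nonneg_nonneg divide_nonneg_nonneg norm0_sq_nonneg f) (auto intro: add_nonneg_nonneg)
  then show ?thesis
    using refined_bohr[OF f, of "cmod w"] dist_le_majorant[OF f w] w by simp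
qed

section \<open>Functions vanishing at the origin\<close>

text \<open>The Schwarz lemma for zeros of order at least \<open>m\<close>: divide by \<open>z\<close> and use induction.\<close>

lemma norm_le_power_of_vanishing_order:
  assumes "g holomorphic_on unit_disc" "\<And>z. z \<in> unit_disc \<Longrightarrow> cmod (g z) \<le> 1"
    "\<And>k. k < m \<Longrightarrow> taylor_coeff g k = 0" "cmod z < 1"
  shows "cmod (g z) \<le> cmod z ^ m"
  using assms
proof (induction m arbitrary: g z)
  case 0
  then show ?case by simp
next
  case (Suc m)
  note hol = Suc.prems(1) and le1 = Suc.prems(2) and van = Suc.prems(3)
  have g0: "g 0 = 0" using van[of 0] by (simp add: fps_expansion_def)
  \<comment> \<open>the Schwarz lemma is applied with a strict bound, which the maximum principle supplies\<close>
  have lt1: "cmod (g z) < 1" if z: "cmod z < 1" for z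
  proof (rule ccontr)
    assume "\<not> cmod (g z) < 1"
    then have "cmod (g w) \<le> cmod (g z)" if "w \<in> unit_disc" for w
      using le1[OF that] by linarith
    then have "g constant_on unit_disc"
      using z by (intro maximum_modulus_principle[OF hol, of unit_disc z]) auto
    then have "g z = g 0" using z by (auto simp: constant_on_def)
    with g0 \<open>\<not> cmod (g z) < 1\<close> show False by simp
  qed
  obtain h where h: "h holomorphic_on unit_disc" "\<And>z. cmod z < 1 \<Longrightarrow> g z = z * h z" "deriv g 0 = h 0"
    using Schwarz3[OF hol g0] by blast
  have h1: "cmod (h z) \<le> 1" if z: "z \<in> unit_disc" for z
  proof (cases "z = 0")
    case True
    then show ?thesis using Schwarz_Lemma(2)[OF hol g0 lt1 z[simplified]] h(3) by simp
  next
    case False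
    have "cmod z * cmod (h z) \<le> cmod z * 1"
      using Schwarz_Lemma(1)[OF hol g0 lt1, of z] h(2)[of z] z by (simp add: norm_mult)
    then show ?thesis using False by simp
  qed
  have hexp: "h has_fps_expansion fps_expansion h 0"
    by (rule has_fps_expansion_fps_expansion[OF _ _ h(1)]) auto
  have "(\<lambda>z. z * h z) has_fps_expansion fps_X * fps_expansion h 0"
    by (intro fps_expansion_intros hexp)
  moreover have ev: "eventually (\<lambda>z. z * h z = g z) (nhds 0)"
    using h(2) by (auto simp: eventually_nhds intro!: exI[of _ unit_disc])
  ultimately have "g has_fps_expansion fps_X * fps_expansion h 0"
    using has_fps_expansion_cong[OF ev HOL.refl] by simp
  then have "fps_expansion g 0 = fps_X * fps_expansion h 0" by (rule fps_expansion_eqI)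
  then have "taylor_coeff h k = taylor_coeff g (Suc k)" for k by simp
  then have "cmod (h z) \<le> cmod z ^ m"
    using van by (intro Suc.IH h h1 Suc.prems(4)) auto
  then show ?case
    using h(2)[OF Suc.prems(4)] by (simp add: norm_mult mult_left_mono)
qed

section \<open>The equations for the radii\<close>

text \<open>The function \<open>E(r) = r/(1 - r) + r\<^sup>m/(1 - r\<^sup>m)\<close> of the overview above, meant for \<open>m \<ge> 1\<close> and \<open>0 \<le> r < 1\<close>.\<close>

definition bohr_sum :: "nat \<Rightarrow> real \<Rightarrow> real" where
  "bohr_sum m r = r / (1 - r) + r ^ m / (1 - r ^ m)"

lemma bohr_sum_strict_mono:
  assumes "m \<ge> 1" "0 \<le> r" "r < s" "s < 1"
  shows "bohr_sum m r < bohr_sum m s"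
proof -
  have frac: "x / (1 - x) < y / (1 - y)" if "x < y" "y < 1" for x y :: real
    using that by (simp add: field_simps)
  have "r ^ m < s ^ m" using assms by (intro power_strict_mono) auto
  moreover have "s ^ m < 1" using assms by (simp add: power_less_one_iff)
  ultimately show ?thesis
    unfolding bohr_sum_def using assms by (intro add_strict_mono frac) auto
qed

lemma bohr_sum_mono:
  assumes "m \<ge> 1" "0 \<le> r" "r \<le> s" "s < 1"
  shows "bohr_sum m r \<le> bohr_sum m s"
  using bohr_sum_strict_mono[of m r s] assms by (cases "r = s") auto

lemma sum_powers_eq:
  fixes r :: real
  assumes "r < 1"
  shows "(\<Sum>k=1..m. r ^ k) = r * (1 - r ^ m) / (1 - r)"
  using assms sum_gp_multiplied[of 1 m r] by (cases "m = 0") (auto simp: field_simps)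

lemma bohr_sum_eq_iff:
  assumes m: "m \<ge> 1" and r: "0 < r" "r < 1"
  shows "r ^ m * (3 - 5 * r) + 3 * r - 1 = 0 \<longleftrightarrow> bohr_sum m r = 1 / 2"
    and "3 * r ^ m + 2 * (\<Sum>k=1..m. r ^ k) - 1 = 0 \<longleftrightarrow> bohr_sum m r = 1 / 2"
    and "r ^ m * (2 - 3 * r) + 2 * r - 1 = 0 \<longleftrightarrow> bohr_sum m r = 1"
    and "2 * r ^ m + (\<Sum>k=1..m. r ^ k) - 1 = 0 \<longleftrightarrow> bohr_sum m r = 1"
proof -
  have p: "r ^ m < 1" using m r by (simp add: power_less_one_iff)
  note sm = sum_powers_eq[OF r(2), of m]
  show "r ^ m * (3 - 5 * r) + 3 * r - 1 = 0 \<longleftrightarrow> bohr_sum m r = 1 / 2"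
    "r ^ m * (2 - 3 * r) + 2 * r - 1 = 0 \<longleftrightarrow> bohr_sum m r = 1"
    using r p unfolding bohr_sum_def by (auto simp: field_simps)
  show "3 * r ^ m + 2 * (\<Sum>k=1..m. r ^ k) - 1 = 0 \<longleftrightarrow> bohr_sum m r = 1 / 2"
    "2 * r ^ m + (\<Sum>k=1..m. r ^ k) - 1 = 0 \<longleftrightarrow> bohr_sum m r = 1"
    using r p unfolding bohr_sum_def sm by (auto simp: field_simps)
qed

text \<open>The right-hand side is the first summand of \<open>E(s)\<close>, so the intermediate value theorem yields a
  root up to \<open>s\<close>. For \<open>s = 1/3\<close> and \<open>s = 1/2\<close> it equals \<open>1/2\<close> and \<open>1\<close>.\<close>

lemma bohr_sum_unique_root:
  assumes m: "m \<ge> 1" and s: "0 < s" "s < 1"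
  shows "\<exists>!r. r \<in> {0<..s} \<and> bohr_sum m r = s / (1 - s)"
proof -
  have ne: "r ^ m \<noteq> 1" if "0 \<le> r" "r \<le> s" for r
    using m s that power_less_one_iff[of r m] by auto
  have "continuous_on {0..s} (bohr_sum m)"
    unfolding bohr_sum_def using s ne by (intro continuous_intros) auto
  moreover have "bohr_sum m 0 = 0" using m by (simp add: bohr_sum_def)
  moreover have "s / (1 - s) \<le> bohr_sum m s" "0 < s / (1 - s)"
    using m s by (auto simp: bohr_sum_def power_le_one)
  ultimately obtain r where r: "0 \<le> r" "r \<le> s" "bohr_sum m r = s / (1 - s)"
    using IVT'[of "bohr_sum m" 0 "s / (1 - s)" s] s by auto
  have "r \<noteq> 0" using \<open>bohr_sum m 0 = 0\<close> r(3) \<open>0 < s / (1 - s)\<close> by auto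
  show ?thesis
  proof (rule ex1I[of _ r])
    show "r \<in> {0<..s} \<and> bohr_sum m r = s / (1 - s)" using r \<open>r \<noteq> 0\<close> by auto
    show "r' = r" if "r' \<in> {0<..s} \<and> bohr_sum m r' = s / (1 - s)" for r'
      using bohr_sum_strict_mono[OF m, of r r'] bohr_sum_strict_mono[OF m, of r' r] that r s
      by (cases r r' rule: linorder_cases) auto
  qed
qed

section \<open>The common part of both functionals\<close>

text \<open>Up to the factor \<open>1 - a\<^sup>2\<close>, the two summands of \<open>E(r)\<close> bound the coefficient part (at \<open>r\<close>) and the distance term (at
  \<open>|\<omega>(z)| \<le> r\<^sup>m\<close>), respectively.\<close>

lemma bohr_functional_upper:
  assumes f: "f \<in> bounded_class" and \<omega>: "\<omega> \<in> schwarz_class m" and m: "m \<ge> 1" and z: "cmod z < 1"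
  defines "r \<equiv> cmod z" and "a \<equiv> cmod (taylor_coeff f 0)"
  shows "majorant 1 f r + (1 + a * r) / ((1 + a) * (1 - r)) * norm0_sq f r
    + cmod (f (\<omega> z) - taylor_coeff f 0) \<le> (1 - a\<^sup>2) * bohr_sum m r"
proof -
  have "\<omega> \<in> bounded_class" using \<omega> by (simp add: schwarz_class_def)
  then have w: "cmod (\<omega> z) \<le> r ^ m"
    unfolding r_def using \<omega> z
    by (intro norm_le_power_of_vanishing_order bounded_class_holomorphic)
      (auto simp: bounded_class_def schwarz_class_def fps_expansion_def)
  have p: "r ^ m < 1" using m z by (simp add: r_def power_less_one_iff)
  have a: "a\<^sup>2 \<le> 1" using coeff_le_one[OF f, of 0] by (simp add: a_def abs_square_le_1)
  have "cmod (f (\<omega> z) - taylor_coeff f 0) \<le> (1 - a\<^sup>2) * (cmod (\<omega> z) / (1 - cmod (\<omega> z)))"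
    unfolding a_def using w p by (intro dist_bound f) auto
  also have "\<dots> \<le> (1 - a\<^sup>2) * (r ^ m / (1 - r ^ m))"
    using w p a z by (intro mult_left_mono frac_le) (auto simp: r_def)
  finally show ?thesis
    using refined_bohr[OF f, of r] z unfolding bohr_sum_def distrib_left
    by (simp add: r_def a_def)
qed

lemma schwarz_class_power: "(\<lambda>z. z ^ m) \<in> schwarz_class m"
proof -
  have "(\<lambda>z::complex. z ^ m) analytic_on unit_disc" by (intro analytic_intros)
  moreover have "(deriv ^^ k) (\<lambda>z::complex. z ^ m) 0 = (if k = m then fact m else 0)" if "k \<le> m" for k
    using that higher_deriv_power[of k 0 m "0::complex"] by (auto simp: pochhammer_fact)
  ultimately show ?thesis
    by (auto simp: schwarz_class_def bounded_class_def norm_power power_le_one)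
qed

text \<open>The function is \<open>f(z) = (a - z)/(1 - az)\<close>, for which \<open>|f(x) - a| = (1 - a\<^sup>2) x/(1 - ax)\<close> when \<open>0 < x < 1\<close>.
  This also bounds \<open>B\<^sub>1(f,r)\<close> from below, so that no Taylor coefficients need to be computed.\<close>

lemma bohr_functional_extremal:
  assumes a: "0 < a" "a < 1" and r: "0 < r" "r < 1" and m: "m \<ge> 1"
  obtains f where "f \<in> bounded_class" "taylor_coeff f 0 = of_real a"
    "(1 - a\<^sup>2) * (r / (1 - a * r) + r ^ m / (1 - a * r ^ m)) \<le>
      majorant 1 f r + (1 + a * r) / ((1 + a) * (1 - r)) * norm0_sq f r
      + cmod (f (of_real r ^ m) - taylor_coeff f 0)"
proof -
  define f where "f z = - Moebius_function 0 (of_real a) z" for z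
  have "f holomorphic_on unit_disc"
    unfolding f_def[abs_def] using a by (intro holomorphic_intros Moebius_function_holomorphic) auto
  moreover have "cmod (f z) \<le> 1" if "z \<in> unit_disc" for z
    using that a Moebius_function_norm_lt_1[of "of_real a" z 0] by (simp add: f_def)
  ultimately have f: "f \<in> bounded_class" by (simp add: bounded_class_def analytic_on_open)
  have a0: "taylor_coeff f 0 = of_real a"
    by (simp add: fps_expansion_def f_def Moebius_function_def)
  have diff: "cmod (f (of_real x) - taylor_coeff f 0) = (1 - a\<^sup>2) * (x / (1 - a * x))"
    if x: "0 < x" "x < 1" for x
  proof -
    have ax: "a * x < 1" using mult_strict_mono[of a 1 x 1] a x by simp
    have "f (of_real x) - taylor_coeff f 0 = of_real (- ((1 - a\<^sup>2) * (x / (1 - a * x))))"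
    proof -
      have "- ((x - a) / (1 - a * x)) - a = - ((1 - a\<^sup>2) * (x / (1 - a * x)))"
        using ax by (simp add: field_simps power2_eq_square)
      moreover have "f (of_real x) - taylor_coeff f 0 = of_real (- ((x - a) / (1 - a * x)) - a)"
        unfolding a0 by (simp add: f_def Moebius_function_def)
      ultimately show ?thesis by simp
    qed
    moreover have "0 \<le> (1 - a\<^sup>2) * (x / (1 - a * x))"
      using a x ax by (intro mult_nonneg_nonneg divide_nonneg_nonneg) (auto simp: power_le_one)
    ultimately show ?thesis by (simp only: norm_of_real abs_minus_cancel abs_of_nonneg)
  qed
  have "r ^ m < 1" "0 < r ^ m" using m r by (auto simp: power_less_one_iff)
  then have "cmod (f (of_real r ^ m) - taylor_coeff f 0) = (1 - a\<^sup>2) * (r ^ m / (1 - a * r ^ m))"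
    using diff[of "r ^ m"] by simp
  moreover have "(1 - a\<^sup>2) * (r / (1 - a * r)) \<le> majorant 1 f r"
    using dist_le_majorant[OF f, of "of_real r"] diff[OF r] r by simp
  moreover have "0 \<le> (1 + a * r) / ((1 + a) * (1 - r)) * norm0_sq f r"
    using a r by (intro mult_nonneg_nonneg divide_nonneg_nonneg norm0_sq_nonneg f) auto
  ultimately show ?thesis
    using that[OF f a0] by (simp add: distrib_left)
qed

text \<open>A functional exceeds \<open>1\<close> when the part common to both exceeds \<open>(1 - a\<^sup>2) c(a)\<close>, where \<open>c(a) = 1/(1 + a)\<close> if
  the remaining summand is \<open>a\<close>, and \<open>c(a) = 1\<close> if it is \<open>a\<^sup>2\<close>.\<close>

lemma bohr_functional_sharp:
  assumes \<rho>: "0 < \<rho>" "\<rho> < 1" and m: "m \<ge> 1"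
    and c: "isCont c 1" "c 1 < bohr_sum m \<rho>"
  obtains f a where "0 < a" "a < 1" "f \<in> bounded_class" "taylor_coeff f 0 = of_real a"
    "(1 - a\<^sup>2) * c a < majorant 1 f \<rho> + (1 + a * \<rho>) / ((1 + a) * (1 - \<rho>)) * norm0_sq f \<rho>
      + cmod (f (of_real \<rho> ^ m) - taylor_coeff f 0)"
proof -
  let ?E = "\<lambda>a. \<rho> / (1 - a * \<rho>) + \<rho> ^ m / (1 - a * \<rho> ^ m)"
  have p: "0 < \<rho> ^ m" "\<rho> ^ m < 1" using \<rho> m by (auto simp: power_less_one_iff)
  have "(?E \<longlongrightarrow> \<rho> / (1 - 1 * \<rho>) + \<rho> ^ m / (1 - 1 * \<rho> ^ m)) (at_left 1)"
    using \<rho> p by (intro tendsto_intros) auto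
  moreover have "(c \<longlongrightarrow> c 1) (at_left 1)"
    using c(1) by (simp add: isCont_def filterlim_at_split)
  ultimately have "((\<lambda>a. ?E a - c a) \<longlongrightarrow> bohr_sum m \<rho> - c 1) (at_left 1)"
    unfolding bohr_sum_def by (intro tendsto_diff) simp_all
  then have "eventually (\<lambda>a. 0 < ?E a - c a) (at_left 1)"
    by (rule order_tendstoD) (use c(2) in simp)
  moreover have "eventually (\<lambda>a::real. a \<in> {0<..<1}) (at_left 1)"
    by (rule eventually_at_left_real) simp
  ultimately have "eventually (\<lambda>a. 0 < ?E a - c a \<and> a \<in> {0<..<1}) (at_left 1)"
    by (rule eventually_conj)
  then obtain a where a: "c a < ?E a" "0 < a" "a < 1"
    using eventually_happens'[of "at_left (1::real)"] by (auto simp: trivial_limit_at_left_real)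
  have "0 < 1 - a\<^sup>2" using a by (simp add: abs_square_less_1)
  then have lt: "(1 - a\<^sup>2) * c a < (1 - a\<^sup>2) * ?E a"
    by (rule mult_strict_left_mono[OF a(1)])
  obtain f where f: "f \<in> bounded_class" "taylor_coeff f 0 = of_real a"
    "(1 - a\<^sup>2) * ?E a \<le> majorant 1 f \<rho> + (1 + a * \<rho>) / ((1 + a) * (1 - \<rho>)) * norm0_sq f \<rho>
      + cmod (f (of_real \<rho> ^ m) - taylor_coeff f 0)"
    by (rule bohr_functional_extremal[OF a(2,3) \<rho> m])
  show ?thesis
    by (rule that[OF a(2,3) f(1,2) less_le_trans[OF lt f(3)]])
qed

section \<open>The two Bohr radii\<close>

theorem theorem2:
  fixes m :: nat
  assumes "m \<ge> 1"
  shows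
    "(\<exists>!r::real. r \<in> {0<..1/3} \<and> r ^ m * (3 - 5 * r) + 3 * r - 1 = 0)
     \<and> (\<forall>r::real. r \<in> {0<..1/3} \<longrightarrow>
          (r ^ m * (3 - 5 * r) + 3 * r - 1 = 0
           \<longleftrightarrow> 3 * r ^ m + 2 * (\<Sum>k=1..m. r ^ k) - 1 = 0))
     \<and> (\<forall>f\<in>bounded_class. \<forall>\<omega>\<in>schwarz_class m. \<forall>z.
          cmod z \<le> zeta_root m \<longrightarrow> C_fun f \<omega> z \<le> 1)
     \<and> \<not> (\<exists>\<rho>. zeta_root m < \<rho> \<and> \<rho> < 1 \<and>
          (\<forall>f\<in>bounded_class. \<forall>\<omega>\<in>schwarz_class m. \<forall>z.
             cmod z \<le> \<rho> \<longrightarrow> C_fun f \<omega> z \<le> 1))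
     \<and> (\<exists>!r::real. r \<in> {0<..1/2} \<and> r ^ m * (2 - 3 * r) + 2 * r - 1 = 0)
     \<and> (\<forall>r::real. r \<in> {0<..1/2} \<longrightarrow>
          (r ^ m * (2 - 3 * r) + 2 * r - 1 = 0
           \<longleftrightarrow> 2 * r ^ m + (\<Sum>k=1..m. r ^ k) - 1 = 0))
     \<and> (\<forall>f\<in>bounded_class. \<forall>\<omega>\<in>schwarz_class m. \<forall>z.
          cmod z \<le> eta_root m \<longrightarrow> D_fun f \<omega> z \<le> 1)
     \<and> \<not> (\<exists>\<rho>. eta_root m < \<rho> \<and> \<rho> < 1 \<and>
          (\<forall>f\<in>bounded_class. \<forall>\<omega>\<in>schwarz_class m. \<forall>z.
             cmod z \<le> \<rho> \<longrightarrow> D_fun f \<omega> z \<le> 1))"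
proof -
  let ?z = "zeta_root m" and ?e = "eta_root m"
  have z_ex: "\<exists>!r::real. r \<in> {0<..1/3} \<and> r ^ m * (3 - 5 * r) + 3 * r - 1 = 0"
  proof -
    have "(r \<in> {0<..1/3} \<and> bohr_sum m r = (1/3) / (1 - 1/3)) \<longleftrightarrow>
        (r \<in> {0<..1/3} \<and> r ^ m * (3 - 5 * r) + 3 * r - 1 = 0)" for r
      using bohr_sum_eq_iff(1)[OF assms, of r] by auto
    then show ?thesis
      using bohr_sum_unique_root[OF assms, of "1/3"] by simp
  qed
  have e_ex: "\<exists>!r::real. r \<in> {0<..1/2} \<and> r ^ m * (2 - 3 * r) + 2 * r - 1 = 0"
  proof -
    have "(r \<in> {0<..1/2} \<and> bohr_sum m r = (1/2) / (1 - 1/2)) \<longleftrightarrow>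
        (r \<in> {0<..1/2} \<and> r ^ m * (2 - 3 * r) + 2 * r - 1 = 0)" for r
      using bohr_sum_eq_iff(3)[OF assms, of r] by auto
    then show ?thesis
      using bohr_sum_unique_root[OF assms, of "1/2"] by simp
  qed
  have z: "0 < ?z" "?z < 1" "bohr_sum m ?z = 1/2"
    using theI'[OF z_ex] bohr_sum_eq_iff(1)[OF assms, of ?z] by (auto simp: zeta_root_def)
  have e: "0 < ?e" "?e < 1" "bohr_sum m ?e = 1"
    using theI'[OF e_ex] bohr_sum_eq_iff(3)[OF assms, of ?e] by (auto simp: eta_root_def)
  have C_le: "C_fun f \<omega> w \<le> 1"
    if f: "f \<in> bounded_class" and \<omega>: "\<omega> \<in> schwarz_class m" and w: "cmod w \<le> ?z" for f \<omega> w
  proof -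
    define a where "a = cmod (taylor_coeff f 0)"
    have a: "0 \<le> a" "a \<le> 1" using coeff_le_one[OF f, of 0] by (simp_all add: a_def)
    have w1: "cmod w < 1" using w z by linarith
    have "C_fun f \<omega> w \<le> a + (1 - a\<^sup>2) * bohr_sum m (cmod w)"
      using bohr_functional_upper[OF f \<omega> assms w1] majorant_0[OF f _ w1]
      by (simp add: C_fun_def Let_def a_def)
    also have "\<dots> \<le> a + (1 - a\<^sup>2) * (1/2)"
      using bohr_sum_mono[OF assms _ w] z a
      by (intro add_left_mono mult_left_mono) (auto simp: abs_square_le_1)
    also have "\<dots> = 1 - (1 - a)\<^sup>2 / 2"
      by (simp add: power2_eq_square field_simps)
    finally show ?thesis using zero_le_power2[of "1 - a"] by linarith
  qed
  have D_le: "D_fun f \<omega> w \<le> 1"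
    if f: "f \<in> bounded_class" and \<omega>: "\<omega> \<in> schwarz_class m" and w: "cmod w \<le> ?e" for f \<omega> w
  proof -
    define a where "a = cmod (taylor_coeff f 0)"
    have a: "0 \<le> a" "a \<le> 1" using coeff_le_one[OF f, of 0] by (simp_all add: a_def)
    have w1: "cmod w < 1" using w e by linarith
    have "D_fun f \<omega> w \<le> a\<^sup>2 + (1 - a\<^sup>2) * bohr_sum m (cmod w)"
      using bohr_functional_upper[OF f \<omega> assms w1]
      by (simp add: D_fun_def Let_def a_def)
    also have "\<dots> \<le> a\<^sup>2 + (1 - a\<^sup>2) * 1"
      using bohr_sum_mono[OF assms _ w] e a
      by (intro add_left_mono mult_left_mono) (auto simp: abs_square_le_1)
    finally show ?thesis by simp
  qed
  have C_sharp: "\<exists>f\<in>bounded_class. \<exists>\<omega>\<in>schwarz_class m. \<exists>w. cmod w \<le> \<rho> \<and> 1 < C_fun f \<omega> w"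
    if \<rho>: "?z < \<rho>" "\<rho> < 1" for \<rho>
  proof -
    have \<rho>0: "0 < \<rho>" using z \<rho> by linarith
    have c: "isCont (\<lambda>a::real. 1 / (1 + a)) 1"
      by (intro continuous_intros) auto
    have "1 / (1 + 1) < bohr_sum m \<rho>"
      using bohr_sum_strict_mono[OF assms _ \<rho>] z by simp
    then obtain f a where f: "0 < a" "a < 1" "f \<in> bounded_class" "taylor_coeff f 0 = of_real a"
      "(1 - a\<^sup>2) * (1 / (1 + a)) < majorant 1 f \<rho> + (1 + a * \<rho>) / ((1 + a) * (1 - \<rho>)) * norm0_sq f \<rho>
      + cmod (f (of_real \<rho> ^ m) - taylor_coeff f 0)"
      by (rule bohr_functional_sharp[OF \<rho>0 \<rho>(2) assms c])
    have "(1 - a\<^sup>2) * (1 / (1 + a)) = 1 - a"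
      using f(1) by (simp add: field_simps power2_eq_square)
    then have "1 < C_fun f (\<lambda>z. z ^ m) (of_real \<rho>)"
      using f \<rho>0 \<rho>(2) majorant_0[OF f(3), of \<rho>] by (simp add: C_fun_def Let_def)
    then show ?thesis
      using \<rho>0 by (intro bexI[OF _ f(3)] bexI[OF _ schwarz_class_power] exI[of _ "of_real \<rho>"]) simp
  qed
  have D_sharp: "\<exists>f\<in>bounded_class. \<exists>\<omega>\<in>schwarz_class m. \<exists>w. cmod w \<le> \<rho> \<and> 1 < D_fun f \<omega> w"
    if \<rho>: "?e < \<rho>" "\<rho> < 1" for \<rho>
  proof -
    have \<rho>0: "0 < \<rho>" using e \<rho> by linarith
    have "1 < bohr_sum m \<rho>"
      using bohr_sum_strict_mono[OF assms _ \<rho>] e by simp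
    then obtain f a where f: "0 < a" "a < 1" "f \<in> bounded_class" "taylor_coeff f 0 = of_real a"
      "(1 - a\<^sup>2) * 1 < majorant 1 f \<rho> + (1 + a * \<rho>) / ((1 + a) * (1 - \<rho>)) * norm0_sq f \<rho>
      + cmod (f (of_real \<rho> ^ m) - taylor_coeff f 0)"
      by (rule bohr_functional_sharp[OF \<rho>0 \<rho>(2) assms continuous_const])
    then have "1 < D_fun f (\<lambda>z. z ^ m) (of_real \<rho>)"
      using \<rho>0 by (simp add: D_fun_def Let_def)
    then show ?thesis
      using \<rho>0 by (intro bexI[OF _ f(3)] bexI[OF _ schwarz_class_power] exI[of _ "of_real \<rho>"]) simp
  qed
  show ?thesis
  proof (intro conjI)
    show "\<forall>r::real. r \<in> {0<..1/3} \<longrightarrow>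
          (r ^ m * (3 - 5 * r) + 3 * r - 1 = 0
           \<longleftrightarrow> 3 * r ^ m + 2 * (\<Sum>k=1..m. r ^ k) - 1 = 0)"
      using bohr_sum_eq_iff(1,2)[OF assms] by simp
    show "\<forall>r::real. r \<in> {0<..1/2} \<longrightarrow>
          (r ^ m * (2 - 3 * r) + 2 * r - 1 = 0
           \<longleftrightarrow> 2 * r ^ m + (\<Sum>k=1..m. r ^ k) - 1 = 0)"
      using bohr_sum_eq_iff(3,4)[OF assms] by simp
    show "\<not> (\<exists>\<rho>. ?z < \<rho> \<and> \<rho> < 1 \<and> (\<forall>f\<in>bounded_class. \<forall>\<omega>\<in>schwarz_class m. \<forall>z.
             cmod z \<le> \<rho> \<longrightarrow> C_fun f \<omega> z \<le> 1))"
      using C_sharp by (metis linorder_not_less)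
    show "\<not> (\<exists>\<rho>. ?e < \<rho> \<and> \<rho> < 1 \<and> (\<forall>f\<in>bounded_class. \<forall>\<omega>\<in>schwarz_class m. \<forall>z.
             cmod z \<le> \<rho> \<longrightarrow> D_fun f \<omega> z \<le> 1))"
      using D_sharp by (metis linorder_not_less)
  qed (use z_ex e_ex C_le D_le in auto)
qed

end
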